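(* Let $d\ge 1$ and let $L$ be a $d$-dimensional integration lattice such that the lattice point set $\mathcal{P}(L)=L\cap[0,1)^d$ has exactly $N$ elements. Then $$J_N(\mathcal{P}(L))\ \ge\ \frac{c_d}{N^{1/d}},\qquad c_d=\frac12\sqrt{\frac{\pi}{d}}\left(\Gamma\!\left(\tfrac d2+1\right)\right)^{-1/d}.$$ Moreover, there exists an absolute constant $c>0$ (independent of $d$, $L$ and $N$) such that, for every $d\ge1$ and every such $L$ which additionally satisfies $\sigma(L)\le 1/2$, we have $$J_N(\mathcal{P}(L))\ \ge\ c\left(\Gamma\!\left(\tfrac d2+1\right)\right)^{-1/d}\frac{1}{N^{1/d}}.$$
   Context: A $d$-dimensional lattice is a set $L=\{\sum_{i=1}^d k_i\boldsymbol b_i: k_i\in\mathbb Z\}$ where $\boldsymbol b_1,\dots,\boldsymbol b_d$ is a basis of $\mathbb R^d$. An integration lattice is a lattice with $\mathbb Z^d\subseteq L$. For an integration lattice $L$, the lattice point set is $\mathcal P(L)=L\cap[0,1)^d$ (a finite set). The dual lattice is $L^\perp=\{\boldsymbol h\in\mathbb R^d: \boldsymbol h\cdot\boldsymbol g\in\mathbb Z \text{ for all }\boldsymbol g\in L\}$, and the spectral test is $\sigma(L)=1/\min\{\|\boldsymbol h\|_2:\boldsymbol h\in L^\perp\setminus\{\boldsymbol 0\}\}$. For a finite point set $\mathcal P=\{\boldsymbol x_0,\dots,\boldsymbol x_{N-1}\}\subset[0,1)^d$ the isotropic discrepancy is $J_N(\mathcal P)=\sup_C\left|\frac{\#\{n:0\le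 n<N,\ \boldsymbol x_n\in C\}}{N}-\mathrm{volume}(C)\right|$, the supremum over all convex subsets $C\subseteq[0,1)^d$. *)

theory Defs
  imports "HOL-Analysis.Analysis" "HOL-Analysis.Finite_Function_Topology"
begin

text \<open>
  The constant in the second lower bound is independent of the dimension, so the dimension has to
  be a natural number that can be quantified over inside a formula, not an index type. Vectors are
  finitely supported real sequences; \<open>\<real>\<^sup>d\<close> is the subspace of those supported on the
  first \<open>d\<close> coordinates. All these spaces live in one type of class \<open>real_vector\<close>, so
  \<^const>\<open>independent\<close>, \<^const>\<open>span\<close> and \<^const>\<open>convex\<close> are the library
  notions. The library norm on this type is the \<open>l\<^sup>1\<close> norm and is not used here.
\<close>

type_synonym rvec = "(nat, real) poly_mapping"

definition Rd :: "nat \<Rightarrow> rvec set" where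
  "Rd d = {x. Poly_Mapping.keys x \<subseteq> {..<d}}"

definition Zd :: "nat \<Rightarrow> rvec set" where
  "Zd d = {x \<in> Rd d. \<forall>i<d. Poly_Mapping.lookup x i \<in> \<int>}"

definition unit_cube :: "nat \<Rightarrow> rvec set" where
  "unit_cube d = {x \<in> Rd d. \<forall>i<d. 0 \<le> Poly_Mapping.lookup x i \<and> Poly_Mapping.lookup x i < 1}"

definition dot :: "nat \<Rightarrow> rvec \<Rightarrow> rvec \<Rightarrow> real" where
  "dot d x y = (\<Sum>i<d. Poly_Mapping.lookup x i * Poly_Mapping.lookup y i)"

definition norm2 :: "nat \<Rightarrow> rvec \<Rightarrow> real" where
  "norm2 d x = L2_set (Poly_Mapping.lookup x) {..<d}"

definition basis_of_Rd :: "nat \<Rightarrow> (nat \<Rightarrow> rvec) \<Rightarrow> bool" where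
  "basis_of_Rd d b \<longleftrightarrow>
     inj_on b {..<d} \<and> independent (b ` {..<d}) \<and> span (b ` {..<d}) = Rd d"

definition lattice_in :: "nat \<Rightarrow> rvec set \<Rightarrow> bool" where
  "lattice_in d L \<longleftrightarrow>
     (\<exists>b. basis_of_Rd d b \<and>
          L = {\<Sum>i<d. of_int (k i) *\<^sub>R b i | k :: nat \<Rightarrow> int. True})"

definition integration_lattice :: "nat \<Rightarrow> rvec set \<Rightarrow> bool" where
  "integration_lattice d L \<longleftrightarrow> lattice_in d L \<and> Zd d \<subseteq> L"

definition lattice_points :: "nat \<Rightarrow> rvec set \<Rightarrow> rvec set" where
  "lattice_points d L = L \<inter> unit_cube d"

definition dual_lattice :: "nat \<Rightarrow> rvec set \<Rightarrow> rvec set" where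
  "dual_lattice d L = {h \<in> Rd d. \<forall>g\<in>L. dot d h g \<in> \<int>}"

text \<open>
  The minimum is over an infinite set, where \<^const>\<open>Min\<close> is of no use; \<^const>\<open>Least\<close> is the
  minimum whenever it is attained. It is attained for integration lattices of dimension
  \<open>d \<ge> 1\<close>, whose dual lattice is contained in \<open>\<int>\<^sup>d\<close>.
\<close>

definition spectral_test :: "nat \<Rightarrow> rvec set \<Rightarrow> real" where
  "spectral_test d L = 1 / (LEAST r. r \<in> norm2 d ` (dual_lattice d L - {0}))"

text \<open>
  Lebesgue measure on \<open>\<real>\<^sup>d\<close>, transported along the coordinate functions. Completing the
  product measure matters: a convex set is always Lebesgue measurable but need not be Borel.
\<close>

definition lebesgue_volume :: "nat \<Rightarrow> rvec set \<Rightarrow> real" where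
  "lebesgue_volume d C =
     measure (completion (Pi\<^sub>M {..<d} (\<lambda>_. lborel)))
       ((\<lambda>x. restrict (Poly_Mapping.lookup x) {..<d}) ` C)"

text \<open>For a point set without repetitions, so that \<open>N = card P\<close>.\<close>

definition isotropic_discrepancy :: "nat \<Rightarrow> rvec set \<Rightarrow> real" where
  "isotropic_discrepancy d P =
     (SUP C \<in> {C. convex C \<and> C \<subseteq> unit_cube d}.
        \<bar>real (card (P \<inter> C)) / real (card P) - lebesgue_volume d C\<bar>)"

end

theory Submission
  imports Defs
begin

text \<open>
  A vector \<open>h\<close> of the dual lattice is an integer vector, and \<open>L\<close> lies on the hyperplanes
  \<open>h \<bullet> x \<in> \<int>\<close>. Every open slab between two consecutive hyperplanes, cut by the cube, is thus a convex
  set without lattice points, and its volume is a lower bound for the discrepancy. By Minkowski's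
  theorem \<open>h\<close> can be taken of norm arbitrarily close to \<open>R = 2 (N / V)\<^bsup>1/d\<^esup>\<close>, where \<open>V\<close> is the volume of the
  unit ball: the integer vectors dual to \<open>L\<close> have index at most \<open>N\<close> in \<open>\<int>\<^sup>d\<close>, since distinct classes give
  orthogonal characters on the \<open>N\<close> lattice points.

  The number of slabs that meet the cube is the \<open>l\<^sup>1\<close> norm of \<open>h\<close>, at most \<open>\<surd>d\<close> times the Euclidean
  norm, so one of them has volume at least \<open>1 / (\<surd>d \<bar>h\<bar>)\<close>. For the dimension-free
  bound, a random point of the cube satisfies \<open>\<bar>h \<bullet> x - c\<bar> < \<bar>h\<bar>\<close> with probability at least \<open>3/4\<close> by
  Chebyshev's inequality, where \<open>c\<close> is the mean of \<open>h \<bullet> x\<close>; at most \<open>4 \<bar>h\<bar>\<close> slabs cover these points.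
\<close>

section \<open>Integer linear forms and integration lattices modulo integer vectors\<close>

definition ip :: "nat \<Rightarrow> (nat \<Rightarrow> int) \<Rightarrow> (nat \<Rightarrow> real) \<Rightarrow> real" where
  "ip d z x = (\<Sum>i<d. of_int (z i) * x i)"

text \<open>An integration lattice contains \<open>Zd d\<close>, so its dual consists of integer
  vectors and functions into \<open>int\<close> represent all of them. Only the entries of
  \<open>z\<close> below \<open>d\<close> count.\<close>

definition in_dual :: "nat \<Rightarrow> rvec set \<Rightarrow> (nat \<Rightarrow> int) \<Rightarrow> bool" where
  "in_dual d L z \<longleftrightarrow> (\<forall>g\<in>L. ip d z (Poly_Mapping.lookup g) \<in> \<int>)"

lemma lookup_scaleR [simp]:
  "Poly_Mapping.lookup (c *\<^sub>R x) i = c * Poly_Mapping.lookup (x :: rvec) i"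
proof -
  have "finite {i. c *\<^sub>R Poly_Mapping.lookup x i \<noteq> 0}"
    by (rule finite_subset[OF _ finite_keys[of x]]) (auto simp: in_keys_iff)
  then show ?thesis
    by (simp add: scaleR_poly_mapping_def Abs_poly_mapping_inverse)
qed

lemma mem_Rd_iff: "x \<in> Rd d \<longleftrightarrow> (\<forall>i\<ge>d. Poly_Mapping.lookup x i = 0)"
  unfolding Rd_def by (auto simp: in_keys_iff subset_iff) (meson not_less)+

lemma integration_lattice_subset: "integration_lattice d L \<Longrightarrow> L \<subseteq> Rd d"
proof -
  assume "integration_lattice d L"
  then obtain b where b: "span (b ` {..<d}) = Rd d"
    and L: "L = {\<Sum>i<d. of_int (k i) *\<^sub>R b i | k :: nat \<Rightarrow> int. True}"
    unfolding integration_lattice_def lattice_in_def basis_of_Rd_def by auto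
  show ?thesis
    unfolding L b[symmetric] by (auto intro!: span_sum span_scale intro: span_base)
qed

lemma integration_lattice_add:
  assumes "integration_lattice d L" "x \<in> L" "y \<in> L"
  shows "x + y \<in> L"
proof -
  obtain b where L: "L = {\<Sum>i<d. of_int (k i) *\<^sub>R b i | k :: nat \<Rightarrow> int. True}"
    using assms(1) unfolding integration_lattice_def lattice_in_def by auto
  then obtain k l where "x = (\<Sum>i<d. of_int (k i) *\<^sub>R b i)" "y = (\<Sum>i<d. of_int (l i) *\<^sub>R b i)"
    using assms(2,3) by auto
  then have "x + y = (\<Sum>i<d. of_int (k i + l i) *\<^sub>R b i)"
    by (simp add: sum.distrib scaleR_left_distrib)
  then show ?thesis
    unfolding L by (intro CollectI exI[of _ "\<lambda>i. k i + l i"]) auto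
qed

lemma lookup_map_frac [simp]:
  "Poly_Mapping.lookup (Poly_Mapping.map frac x) i = frac (Poly_Mapping.lookup (x :: rvec) i)"
  by (simp add: Poly_Mapping.map.rep_eq when_def)

text \<open>Reduction of the coordinates modulo 1 changes \<open>x\<close> by an integer vector,
  which belongs to \<open>L\<close>. The lattice points thus represent \<open>L\<close> modulo
  \<open>Zd d\<close>.\<close>

lemma map_frac_in_lattice_points:
  assumes "integration_lattice d L" "x \<in> L"
  shows "Poly_Mapping.map frac x \<in> lattice_points d L"
proof -
  have x: "x \<in> Rd d"
    using integration_lattice_subset[OF assms(1)] assms(2) by auto
  have "Poly_Mapping.map frac x - x \<in> Zd d"
    using x by (auto simp: Zd_def mem_Rd_iff lookup_minus frac_def)
  then have "x + (Poly_Mapping.map frac x - x) \<in> L"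
    using assms by (intro integration_lattice_add) (auto simp: integration_lattice_def)
  then show ?thesis
    using x by (auto simp: lattice_points_def unit_cube_def mem_Rd_iff frac_lt_1)
qed

lemma zero_in_lattice_points:
  assumes "integration_lattice d L"
  shows "0 \<in> lattice_points d L"
  using assms by (auto simp: lattice_points_def unit_cube_def mem_Rd_iff Zd_def integration_lattice_def)

lemma ip_add: "ip d z (\<lambda>i. x i + y i) = ip d z x + ip d z y"
  by (simp add: ip_def sum.distrib algebra_simps)

lemma ip_diff_left: "ip d (\<lambda>i. z i - w i) x = ip d z x - ip d w x"
  by (simp add: ip_def sum_subtractf algebra_simps)

text \<open>The difference is the form at the vector of floors. This makes the characters below well
  defined modulo integer vectors.\<close>

lemma ip_frac: "ip d z x - ip d z (\<lambda>i. frac (x i)) \<in> \<int>"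
proof -
  have "ip d z x - ip d z (\<lambda>i. frac (x i)) = (\<Sum>i<d. of_int (z i * \<lfloor>x i\<rfloor>))"
    by (simp add: ip_def frac_def algebra_simps sum_subtractf)
  then show ?thesis by (metis Ints_of_int of_int_sum)
qed

subsection \<open>The index of the dual lattice\<close>

lemma cis_2pi_eq_1_iff: "cis (2 * pi * x) = 1 \<longleftrightarrow> x \<in> \<int>"
proof
  assume "cis (2 * pi * x) = 1"
  then have "cos (2 * pi * x) = 1" by (metis cis.sel(1) one_complex.sel(1))
  then obtain n :: int where "2 * pi * x = n * 2 * pi" by (auto simp: cos_one_2pi_int)
  then show "x \<in> \<int>" by simp
next
  assume "x \<in> \<int>"
  then obtain n :: int where "x = n" by (auto elim: Ints_cases)
  then show "cis (2 * pi * x) = 1"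
    using cis_multiple_2pi[of x] by simp
qed

lemma cis_2pi_cong: "x - y \<in> \<int> \<Longrightarrow> cis (2 * pi * x) = cis (2 * pi * y)"
proof -
  assume "x - y \<in> \<int>"
  then have "cis (2 * pi * (x - y)) * cis (2 * pi * y) = cis (2 * pi * y)"
    by (simp add: cis_2pi_eq_1_iff)
  then show ?thesis by (simp add: cis_mult algebra_simps)
qed

text \<open>Some \<open>u\<close> in \<open>L\<close> gives the character a value other than 1.
  Translation by \<open>u\<close>, taken modulo integer vectors, permutes the lattice points and
  multiplies the sum by that value.\<close>

lemma sum_character_eq_0:
  assumes L: "integration_lattice d L" and fin: "finite (lattice_points d L)"
    and z: "\<not> in_dual d L z"
  shows "(\<Sum>g\<in>lattice_points d L. cis (2 * pi * ip d z (Poly_Mapping.lookup g))) = 0"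
proof -
  let ?P = "lattice_points d L" and ?e = "\<lambda>g. cis (2 * pi * ip d z (Poly_Mapping.lookup g))"
  obtain u where u: "u \<in> L" "ip d z (Poly_Mapping.lookup u) \<notin> \<int>"
    using z by (auto simp: in_dual_def)
  define T where "T g = Poly_Mapping.map frac (g + u)" for g
  have T: "T ` ?P \<subseteq> ?P"
    using map_frac_in_lattice_points[OF L] integration_lattice_add[OF L _ u(1)]
    by (auto simp: T_def lattice_points_def)
  have inj: "inj_on T ?P"
  proof (rule inj_onI, rule poly_mapping_eqI)
    fix g h i assume g: "g \<in> ?P" and h: "h \<in> ?P" and eq: "T g = T h"
    show "Poly_Mapping.lookup g i = Poly_Mapping.lookup h i"
    proof (cases "i < d")
      case True
      \<comment> \<open>Equal fractional parts make the two coordinates differ by an integer; both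
        lie in \<open>[0,1)\<close>, so this integer is 0.\<close>
      have "frac (Poly_Mapping.lookup g i + Poly_Mapping.lookup u i)
          = frac (Poly_Mapping.lookup h i + Poly_Mapping.lookup u i)"
        using arg_cong[OF eq, of "\<lambda>p. Poly_Mapping.lookup p i"] by (simp add: T_def lookup_add)
      then have "Poly_Mapping.lookup g i - Poly_Mapping.lookup h i
          = of_int (\<lfloor>Poly_Mapping.lookup g i + Poly_Mapping.lookup u i\<rfloor>
             - \<lfloor>Poly_Mapping.lookup h i + Poly_Mapping.lookup u i\<rfloor>)"
        by (simp add: frac_def)
      moreover have "\<bar>Poly_Mapping.lookup g i - Poly_Mapping.lookup h i\<bar> < 1"
        using g h True by (auto simp: lattice_points_def unit_cube_def abs_less_iff) (smt (verit))+
      ultimately show ?thesis by (metis abs_0 eq_iff_diff_eq_0 of_int_0 of_int_1 of_int_abs of_int_less_iff zabs_less_one_iff)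
    next
      case False
      then show ?thesis using g h by (auto simp: lattice_points_def unit_cube_def mem_Rd_iff)
    qed
  qed
  have TP: "T ` ?P = ?P" by (rule endo_inj_surj[OF fin T inj])
  have step: "?e (T g) = ?e g * ?e u" for g
  proof -
    have "?e (T g) = ?e (g + u)"
      unfolding T_def lookup_map_frac
      by (rule cis_2pi_cong[symmetric], rule ip_frac)
    also have "\<dots> = ?e g * ?e u"
      by (simp add: lookup_add[abs_def] plus_poly_mapping.rep_eq ip_add cis_mult algebra_simps)
    finally show ?thesis .
  qed
  have "(\<Sum>g\<in>?P. ?e g) = (\<Sum>g\<in>?P. ?e (T g))"
    using sum.reindex[OF inj, of ?e] TP by simp
  also have "\<dots> = (\<Sum>g\<in>?P. ?e g) * ?e u"
    unfolding step by (simp add: sum_distrib_right)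
  finally have "(\<Sum>g\<in>?P. ?e g) * (1 - ?e u) = 0" by (simp add: algebra_simps)
  moreover have "?e u \<noteq> 1" using u(2) by (simp add: cis_2pi_eq_1_iff)
  ultimately show ?thesis by simp
qed

text \<open>
  Bessel's inequality at the point \<open>0\<close>: the sum \<open>K\<close> of the \<open>card Z\<close> orthogonal characters satisfies
  \<open>(card Z)\<^sup>2 = \<bar>K 0\<bar>\<^sup>2 \<le> (\<Sum>g. \<bar>K g\<bar>\<^sup>2) = card Z * card P\<close>.
\<close>

lemma card_incongruent_mod_dual_le:
  assumes L: "integration_lattice d L" and fin: "finite (lattice_points d L)" and "finite Z"
    and Z: "\<And>z w. z \<in> Z \<Longrightarrow> w \<in> Z \<Longrightarrow> z \<noteq> w \<Longrightarrow> \<not> in_dual d L (\<lambda>i. z i - w i)"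
  shows "card Z \<le> card (lattice_points d L)"
proof -
  let ?P = "lattice_points d L"
  define e where "e z g = cis (2 * pi * ip d z (Poly_Mapping.lookup g))" for z g
  define K where "K g = (\<Sum>z\<in>Z. e z g)" for g
  have orth: "(\<Sum>g\<in>?P. e z g * cnj (e w g)) = (if z = w then of_nat (card ?P) else 0)"
    if "z \<in> Z" "w \<in> Z" for z w
  proof -
    have "e z g * cnj (e w g) = cis (2 * pi * ip d (\<lambda>i. z i - w i) (Poly_Mapping.lookup g))" for g
      by (simp add: e_def cis_cnj cis_mult ip_diff_left algebra_simps)
    then show ?thesis
      using sum_character_eq_0[OF L fin Z[OF that]] by (auto simp: ip_def)
  qed
  have "(\<Sum>g\<in>?P. K g * cnj (K g)) = (\<Sum>g\<in>?P. \<Sum>z\<in>Z. \<Sum>w\<in>Z. e z g * cnj (e w g))"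
    by (simp add: K_def sum_product)
  also have "\<dots> = (\<Sum>z\<in>Z. \<Sum>w\<in>Z. \<Sum>g\<in>?P. e z g * cnj (e w g))"
    by (subst sum.swap, intro sum.cong refl, rule sum.swap)
  also have "\<dots> = (\<Sum>z\<in>Z. \<Sum>w\<in>Z. if z = w then of_nat (card ?P) else 0)"
    by (intro sum.cong refl orth)
  also have "\<dots> = of_nat (card Z * card ?P)"
    using \<open>finite Z\<close> by simp
  finally have "complex_of_real (\<Sum>g\<in>?P. (cmod (K g))\<^sup>2) = complex_of_real (real (card Z * card ?P))"
    by (simp add: complex_mult_cnj cmod_power2)
  then have sum: "(\<Sum>g\<in>?P. (cmod (K g))\<^sup>2) = real (card Z * card ?P)"
    using of_real_eq_iff by blast
  have "(cmod (K 0))\<^sup>2 \<le> (\<Sum>g\<in>?P. (cmod (K g))\<^sup>2)"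
    by (rule member_le_sum) (use fin zero_in_lattice_points[OF L] in auto)
  moreover have "K 0 = of_nat (card Z)"
    by (simp add: K_def e_def ip_def)
  ultimately have "real (card Z * card Z) \<le> real (card Z * card ?P)"
    unfolding sum by (simp add: power2_eq_square)
  then have "card Z * card Z \<le> card Z * card ?P" by (simp only: of_nat_le_iff)
  then show ?thesis by (cases "card Z = 0") auto
qed

section \<open>Lebesgue measure on the product space and its translation invariance\<close>

abbreviation leb_pi :: "nat \<Rightarrow> (nat \<Rightarrow> real) measure" where
  "leb_pi d \<equiv> Pi\<^sub>M {..<d} (\<lambda>_. lborel)"

abbreviation pi_cube :: "nat \<Rightarrow> (nat \<Rightarrow> real) set" where
  "pi_cube d \<equiv> Pi\<^sub>E {..<d} (\<lambda>_. {0..<1})"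

interpretation lborel_product: product_sigma_finite "\<lambda>_::nat. lborel :: real measure"
  by standard

lemma space_leb_pi: "space (leb_pi d) = Pi\<^sub>E {..<d} (\<lambda>_. UNIV)"
  by (simp add: space_PiM)

lemma pi_cube_sets [measurable]: "pi_cube d \<in> sets (leb_pi d)"
  by (rule sets_PiM_I_finite) auto

lemma emeasure_pi_cube: "emeasure (leb_pi d) (pi_cube d) = 1"
  by (subst lborel_product.emeasure_PiM) auto

lemma measure_pi_cube: "measure (leb_pi d) (pi_cube d) = 1"
  by (simp add: measure_def emeasure_pi_cube)

lemma fmeasurable_subset_pi_cube:
  "A \<in> sets (leb_pi d) \<Longrightarrow> A \<subseteq> pi_cube d \<Longrightarrow> A \<in> fmeasurable (leb_pi d)"
  by (rule fmeasurableI2[of "pi_cube d"]) (auto simp: fmeasurable_def emeasure_pi_cube)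

lemma borel_measurable_ip [measurable]: "ip d z \<in> borel_measurable (leb_pi d)"
  unfolding ip_def[abs_def] by measurable

text \<open>A product measure is determined by its values on boxes, where invariance reduces to that
  of \<open>lborel\<close> in each coordinate. It serves to move pieces of a ball into the unit
  cube.\<close>

lemma leb_pi_translate:
  "distr (leb_pi d) (leb_pi d) (\<lambda>x. \<lambda>i\<in>{..<d}. c i + x i) = leb_pi d"
proof (rule lborel_product.PiM_eqI)
  fix A :: "nat \<Rightarrow> real set" assume A: "\<And>i. i \<in> {..<d} \<Longrightarrow> A i \<in> sets lborel"
  have A': "((+) (c i)) -` A i \<in> sets lborel" if "i < d" for i
  proof -
    have "((+) (c i)) -` A i \<inter> space borel \<in> sets borel"
      by (rule measurable_sets[of "(+) (c i)" borel borel]) (use A that in auto)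
    then show ?thesis by simp
  qed
  have vim: "(\<lambda>x. \<lambda>i\<in>{..<d}. c i + x i) -` Pi\<^sub>E {..<d} A \<inter> space (leb_pi d)
      = Pi\<^sub>E {..<d} (\<lambda>i. (+) (c i) -` A i)"
    by (auto simp: space_leb_pi PiE_iff)
  have "emeasure (distr (leb_pi d) (leb_pi d) (\<lambda>x. \<lambda>i\<in>{..<d}. c i + x i)) (Pi\<^sub>E {..<d} A)
      = emeasure (leb_pi d) (Pi\<^sub>E {..<d} (\<lambda>i. (+) (c i) -` A i))"
    by (subst emeasure_distr) (use A vim in \<open>auto intro!: sets_PiM_I_finite\<close>)
  also have "\<dots> = (\<Prod>i<d. emeasure lborel ((+) (c i) -` A i))"
    by (rule lborel_product.emeasure_PiM) (use A' in auto)
  also have "\<dots> = (\<Prod>i<d. emeasure lborel (A i))"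
  proof (rule prod.cong)
    fix i assume "i \<in> {..<d}"
    then have "emeasure (distr lborel borel ((+) (c i))) (A i) = emeasure lborel ((+) (c i) -` A i)"
      using A by (subst emeasure_distr) auto
    then show "emeasure lborel ((+) (c i) -` A i) = emeasure lborel (A i)"
      by (simp add: lborel_distr_plus)
  qed simp
  finally show "emeasure (distr (leb_pi d) (leb_pi d) (\<lambda>x. \<lambda>i\<in>{..<d}. c i + x i)) (Pi\<^sub>E {..<d} A)
      = (\<Prod>i<d. emeasure lborel (A i))" .
qed auto

subsection \<open>Short dual vectors\<close>

text \<open>
  Blichfeldt's argument: the translates into the cube of the ball of radius \<open>r/2\<close> cover some point
  more than \<open>N\<close> times, and two of the translation vectors are congruent modulo the dual lattice.
\<close>

lemma exists_short_dual_vector: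
  assumes L: "integration_lattice d L" and fin: "finite (lattice_points d L)" and "r > 0"
    and vol: "real (card (lattice_points d L)) < unit_ball_vol (real d) * (r / 2) ^ d"
  obtains z where "\<exists>i<d. z i \<noteq> 0" "in_dual d L z" "L2_set (\<lambda>i. real_of_int (z i)) {..<d} \<le> r"
proof (rule ccontr)
  assume "\<not> thesis"
  then have none: "\<And>z. \<exists>i<d. z i \<noteq> 0 \<Longrightarrow> L2_set (\<lambda>i. real_of_int (z i)) {..<d} \<le> r \<Longrightarrow> \<not> in_dual d L z"
    using that by blast
  let ?N = "card (lattice_points d L)"
  define S where "S = {f. sqrt (\<Sum>i<d. (f i)\<^sup>2) \<le> r / 2} \<inter> space (leb_pi d)"
  have S_meas [measurable]: "S \<in> sets (leb_pi d)"
  proof -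
    have "S = {f \<in> space (leb_pi d). sqrt (\<Sum>i<d. (f i)\<^sup>2) \<le> r / 2}"
      by (auto simp: S_def)
    also have "\<dots> \<in> sets (leb_pi d)" by measurable
    finally show ?thesis .
  qed
  have emS: "emeasure (leb_pi d) S = ennreal (unit_ball_vol (real d) * (r / 2) ^ d)"
    using emeasure_cball_aux[of "{..<d}" "r / 2"] \<open>r > 0\<close> by (simp add: S_def)
  \<comment> \<open>Points of \<open>S\<close> have coordinates of absolute value at most
    \<open>r / 2\<close>, so this finite box contains all their floor vectors.\<close>
  define Zs where "Zs = (\<Pi>\<^sub>E i\<in>{..<d}. {- \<lceil>r\<rceil>..\<lceil>r\<rceil>})"
  have finZ: "finite Zs" by (auto simp: Zs_def intro!: finite_PiE)
  define tr where "tr z x = (\<lambda>i\<in>{..<d}. real_of_int (z i) + x i)" for z :: "nat \<Rightarrow> int" and x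
  have tr_meas [measurable]: "tr z \<in> measurable (leb_pi d) (leb_pi d)" for z
    unfolding tr_def[abs_def] by measurable
  \<comment> \<open>\<open>B z\<close> is the part of the ball in the unit cell with corner
    \<open>z\<close>, and \<open>A z\<close> is that part shifted by \<open>-z\<close> into the
    cube.\<close>
  define A where "A z = tr z -` S \<inter> pi_cube d" for z
  define B where "B z = S \<inter> Pi\<^sub>E {..<d} (\<lambda>i. {of_int (z i)..<of_int (z i) + 1})" for z :: "nat \<Rightarrow> int"
  have B_meas [measurable]: "B z \<in> sets (leb_pi d)" for z
    unfolding B_def by (intro sets.Int S_meas sets_PiM_I_finite) auto
  have vim: "tr z -` B z \<inter> space (leb_pi d) = A z" for z
  proof -
    have "tr z x \<in> Pi\<^sub>E {..<d} (\<lambda>i. {of_int (z i)..<of_int (z i) + 1}) \<and> x \<in> space (leb_pi d)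
        \<longleftrightarrow> x \<in> pi_cube d" for x
      by (auto simp: tr_def space_leb_pi PiE_iff)
    then show ?thesis unfolding A_def B_def by blast
  qed
  have A_meas [measurable]: "A z \<in> sets (leb_pi d)" for z
    unfolding vim[symmetric] by (rule measurable_sets[OF tr_meas B_meas])
  have AB: "emeasure (leb_pi d) (B z) = emeasure (leb_pi d) (A z)" for z
  proof -
    have "distr (leb_pi d) (leb_pi d) (tr z) = leb_pi d"
      unfolding tr_def[abs_def] by (rule leb_pi_translate)
    then show ?thesis
      using emeasure_distr[OF tr_meas B_meas, of z z] by (simp only: vim)
  qed
  have cover: "S \<subseteq> (\<Union>z\<in>Zs. B z)"
  proof
    fix y assume y: "y \<in> S"
    define z where "z = (\<lambda>i\<in>{..<d}. \<lfloor>y i\<rfloor>)"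
    have yi: "\<bar>y i\<bar> \<le> r / 2" if "i < d" for i
    proof -
      have "\<bar>y i\<bar> = sqrt ((y i)\<^sup>2)" by simp
      also have "\<dots> \<le> sqrt (\<Sum>i<d. (y i)\<^sup>2)"
        using that by (intro real_sqrt_le_mono member_le_sum) auto
      finally show ?thesis using y by (simp add: S_def)
    qed
    have "z \<in> Zs"
      unfolding Zs_def z_def
    proof (rule restrict_PiE_iff[THEN iffD2], rule ballI)
      fix i assume "i \<in> {..<d}"
      then have "\<bar>y i\<bar> \<le> r / 2" using yi by simp
      then have "- r \<le> y i" "y i \<le> r" using \<open>r > 0\<close> by linarith+
      then show "\<lfloor>y i\<rfloor> \<in> {- \<lceil>r\<rceil>..\<lceil>r\<rceil>}"
        by simp linarith
    qed
    moreover have "y \<in> B z"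
      using y by (auto simp: B_def z_def S_def space_leb_pi PiE_iff)
    ultimately show "y \<in> (\<Union>z\<in>Zs. B z)" by auto
  qed
  \<comment> \<open>If \<open>x\<close> lies in \<open>A z\<close> and in \<open>A w\<close>, then
    \<open>z + x\<close> and \<open>w + x\<close> lie in the ball, so \<open>z - w\<close> has norm
    at most \<open>r\<close> and by assumption is not dual. The index bound limits the number of
    such \<open>z\<close>.\<close>
  have mult: "card {z \<in> Zs. x \<in> A z} \<le> ?N" for x
  proof (rule card_incongruent_mod_dual_le[OF L fin])
    show "finite {z \<in> Zs. x \<in> A z}" using finZ by simp
    fix z w assume z: "z \<in> {z \<in> Zs. x \<in> A z}" and w: "w \<in> {z \<in> Zs. x \<in> A z}" and ne: "z \<noteq> w"
    show "\<not> in_dual d L (\<lambda>i. z i - w i)"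
    proof (rule none)
      show "\<exists>i<d. z i - w i \<noteq> 0"
      proof (rule ccontr)
        assume "\<not> ?thesis"
        then have "z = w" using z w by (intro PiE_ext[of z "{..<d}" _ w]) (auto simp: Zs_def)
        then show False using ne by simp
      qed
      have le: "L2_set (\<lambda>i. real_of_int (v i) + x i) {..<d} \<le> r / 2" if "x \<in> A v" for v
        using that by (simp add: A_def S_def tr_def L2_set_def)
      have "L2_set (\<lambda>i. real_of_int (z i - w i)) {..<d}
          = L2_set (\<lambda>i. (real_of_int (z i) + x i) + - (real_of_int (w i) + x i)) {..<d}"
        by simp
      also have "\<dots> \<le> L2_set (\<lambda>i. real_of_int (z i) + x i) {..<d}
          + L2_set (\<lambda>i. - (real_of_int (w i) + x i)) {..<d}"
        by (rule L2_set_triangle_ineq)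
      also have "L2_set (\<lambda>i. - (real_of_int (w i) + x i)) {..<d}
          = L2_set (\<lambda>i. real_of_int (w i) + x i) {..<d}"
        unfolding L2_set_def power2_minus ..
      finally show "L2_set (\<lambda>i. real_of_int (z i - w i)) {..<d} \<le> r"
        using le[of z] le[of w] z w by simp
    qed
  qed
  \<comment> \<open>The volume of the ball is at most the integral over the cube of the number of
    sets \<open>A z\<close> containing \<open>x\<close>, hence at most \<open>?N\<close>, against
    \<open>vol\<close>.\<close>
  have "emeasure (leb_pi d) S \<le> emeasure (leb_pi d) (\<Union>z\<in>Zs. B z)"
    using cover finZ by (intro emeasure_mono) auto
  also have "\<dots> \<le> (\<Sum>z\<in>Zs. emeasure (leb_pi d) (B z))"
    using finZ by (intro emeasure_subadditive_finite) auto
  also have "\<dots> = (\<Sum>z\<in>Zs. \<integral>\<^sup>+x. indicator (A z) x \<partial>leb_pi d)"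
    by (simp add: AB)
  also have "\<dots> = (\<integral>\<^sup>+x. (\<Sum>z\<in>Zs. indicator (A z) x) \<partial>leb_pi d)"
    by (rule nn_integral_sum[symmetric]) auto
  also have "\<dots> \<le> (\<integral>\<^sup>+x. of_nat ?N * indicator (pi_cube d) x \<partial>leb_pi d)"
  proof (rule nn_integral_mono)
    fix x
    show "(\<Sum>z\<in>Zs. indicator (A z) x) \<le> (of_nat ?N * indicator (pi_cube d) x :: ennreal)"
    proof (cases "x \<in> pi_cube d")
      case True
      have "(\<Sum>z\<in>Zs. indicator (A z) x) = (of_nat (card {z \<in> Zs. x \<in> A z}) :: ennreal)"
        using finZ by (simp add: indicator_def sum.If_cases Int_def)
      then show ?thesis using mult[of x] True by simp
    next
      case False
      then show ?thesis by (simp add: A_def)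
    qed
  qed
  also have "\<dots> = of_nat ?N"
    by (simp add: nn_integral_cmult emeasure_pi_cube)
  finally have "unit_ball_vol (real d) * (r / 2) ^ d \<le> real ?N"
    unfolding emS by (simp add: ennreal_of_nat_eq_real_of_nat)
  with vol show False by simp
qed

subsection \<open>Slabs in the cube\<close>

text \<open>Fubini in coordinate \<open>j\<close>: as \<open>z j\<close> is nonzero, each line
  parallel to that axis meets the hyperplane in at most one point.\<close>

lemma emeasure_hyperplane:
  assumes "j < d" "z j \<noteq> 0"
  shows "emeasure (leb_pi d) {x \<in> space (leb_pi d). ip d z x = t} = 0"
proof -
  let ?I = "{..<d} - {j}" and ?H = "{x \<in> space (leb_pi d). ip d z x = t}"
  have I: "{..<d} = insert j ?I" using assms by auto
  have H: "?H \<in> sets (leb_pi d)" by measurable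
  have "emeasure (leb_pi d) ?H = (\<integral>\<^sup>+x. indicator ?H x \<partial>leb_pi d)"
    using H by simp
  also have "\<dots> = (\<integral>\<^sup>+x. (\<integral>\<^sup>+y. indicator ?H (x(j := y)) \<partial>lborel) \<partial>Pi\<^sub>M ?I (\<lambda>_. lborel :: real measure))"
    using lborel_product.product_nn_integral_insert[of ?I j "indicator ?H"] H
    unfolding I[symmetric] by simp
  also have "\<dots> = (\<integral>\<^sup>+x. 0 \<partial>Pi\<^sub>M ?I (\<lambda>_. lborel :: real measure))"
  proof (rule nn_integral_cong)
    fix x
    define c where "c = (t - (\<Sum>i\<in>?I. of_int (z i) * x i)) / of_int (z j)"
    have ip: "ip d z (x(j := y)) = of_int (z j) * y + (\<Sum>i\<in>?I. of_int (z i) * x i)" for y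
    proof -
      have "ip d z (x(j := y)) = (\<Sum>i\<in>insert j ?I. of_int (z i) * (x(j := y)) i)"
        unfolding I[symmetric] ip_def ..
      also have "\<dots> = of_int (z j) * y + (\<Sum>i\<in>?I. of_int (z i) * (x(j := y)) i)"
        by (subst sum.insert) auto
      also have "(\<Sum>i\<in>?I. of_int (z i) * (x(j := y)) i) = (\<Sum>i\<in>?I. of_int (z i) * x i)"
        by (intro sum.cong) auto
      finally show ?thesis .
    qed
    have "(\<integral>\<^sup>+y. indicator ?H (x(j := y)) \<partial>lborel) \<le> (\<integral>\<^sup>+y. indicator {c} y \<partial>lborel)"
      using assms by (intro nn_integral_mono) (auto simp: indicator_def ip c_def field_simps)
    then show "(\<integral>\<^sup>+y. indicator ?H (x(j := y)) \<partial>lborel) = 0" by simp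
  qed
  finally show ?thesis by simp
qed

text \<open>Strict on both sides: if \<open>z\<close> is dual, the form is an integer at every
  lattice point, which keeps these points out of every slab.\<close>

definition slab :: "nat \<Rightarrow> (nat \<Rightarrow> int) \<Rightarrow> int \<Rightarrow> (nat \<Rightarrow> real) set" where
  "slab d z m = {x \<in> pi_cube d. of_int m < ip d z x \<and> ip d z x < of_int m + 1}"

lemma slab_sets [measurable]: "slab d z m \<in> sets (leb_pi d)"
proof -
  have "slab d z m = pi_cube d \<inter> {x \<in> space (leb_pi d). of_int m < ip d z x \<and> ip d z x < of_int m + 1}"
    using sets.sets_into_space[OF pi_cube_sets] by (auto simp: slab_def)
  also have "\<dots> \<in> sets (leb_pi d)" by measurable
  finally show ?thesis .
qed

lemma slab_subset: "slab d z m \<subseteq> pi_cube d"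
  by (auto simp: slab_def)

text \<open>Pigeonhole principle: outside the null set where the form is an integer, the slabs with
  index in \<open>K\<close> cover \<open>E\<close>, so the largest has at least the average share.
  Two choices of \<open>E\<close> and \<open>K\<close> yield the two bounds.\<close>

lemma exists_large_slab:
  assumes z: "\<exists>i<d. z i \<noteq> 0" and E: "E \<in> sets (leb_pi d)" "E \<subseteq> pi_cube d" and "finite K"
    and K: "\<And>x. x \<in> E \<Longrightarrow> ip d z x \<notin> \<int> \<Longrightarrow> \<lfloor>ip d z x\<rfloor> \<in> K" and "measure (leb_pi d) E > 0"
  obtains m where "measure (leb_pi d) E \<le> real (card K) * measure (leb_pi d) (slab d z m)"
proof -
  let ?\<mu> = "measure (leb_pi d)"
  define H where "H = (\<Union>n::int. {x \<in> space (leb_pi d). ip d z x = of_int n})"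
  have H: "H \<in> null_sets (leb_pi d)"
    unfolding H_def
  proof (intro null_sets_UN' null_setsI)
    obtain j where "j < d" "z j \<noteq> 0" using z by blast
    then show "emeasure (leb_pi d) {x \<in> space (leb_pi d). ip d z x = of_int n} = 0" for n :: int
      by (rule emeasure_hyperplane)
    show "{x \<in> space (leb_pi d). ip d z x = of_int n} \<in> sets (leb_pi d)" for n :: int
      by measurable
  qed simp
  have sub: "E - H \<subseteq> (\<Union>m\<in>K. slab d z m)"
  proof
    fix x assume x: "x \<in> E - H"
    then have notin: "ip d z x \<notin> \<int>"
      using sets.sets_into_space[OF E(1)] by (auto simp: H_def elim!: Ints_cases)
    then have "\<lfloor>ip d z x\<rfloor> \<in> K" using K x by auto
    moreover have "of_int \<lfloor>ip d z x\<rfloor> \<noteq> ip d z x" using notin by (metis Ints_of_int)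
    then have "of_int \<lfloor>ip d z x\<rfloor> < ip d z x" "ip d z x < of_int \<lfloor>ip d z x\<rfloor> + 1"
      by linarith+
    then have "x \<in> slab d z \<lfloor>ip d z x\<rfloor>"
      using x E(2) unfolding slab_def by blast
    ultimately show "x \<in> (\<Union>m\<in>K. slab d z m)" by auto
  qed
  have "?\<mu> E = ?\<mu> (E - H)"
    using measure_Diff_null_set[OF E(1) H] by (rule sym)
  also have "\<dots> \<le> ?\<mu> (\<Union>m\<in>K. slab d z m)"
  proof (rule measure_mono_fmeasurable[OF sub])
    show "E - H \<in> sets (leb_pi d)"
      using E(1) null_setsD2[OF H] by (rule sets.Diff)
    show "(\<Union>m\<in>K. slab d z m) \<in> fmeasurable (leb_pi d)"
      using \<open>finite K\<close>
      by (intro fmeasurable_subset_pi_cube sets.finite_UN UN_least slab_sets slab_subset)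
  qed
  also have "\<dots> \<le> (\<Sum>m\<in>K. ?\<mu> (slab d z m))"
    using \<open>finite K\<close> by (intro measure_UNION_le slab_sets)
  finally have le: "?\<mu> E \<le> (\<Sum>m\<in>K. ?\<mu> (slab d z m))" .
  \<comment> \<open>For empty \<open>K\<close> the sum would be 0, against the positive measure of
    \<open>E\<close>; the maximum below needs a nonempty set.\<close>
  with assms(6) have "K \<noteq> {}" by (metis linorder_not_less sum.empty)
  define M where "M = Max ((\<lambda>m. ?\<mu> (slab d z m)) ` K)"
  have "M \<in> (\<lambda>m. ?\<mu> (slab d z m)) ` K"
    unfolding M_def using \<open>finite K\<close> \<open>K \<noteq> {}\<close> by (intro Max_in) auto
  then obtain m where "M = ?\<mu> (slab d z m)" by auto
  moreover have "(\<Sum>m\<in>K. ?\<mu> (slab d z m)) \<le> real (card K) * M"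
    by (rule sum_bounded_above) (use \<open>finite K\<close> in \<open>auto simp: M_def\<close>)
  ultimately show ?thesis using le by (intro that[of m]) simp
qed

subsection \<open>Volumes of slabs\<close>

lemma prod_indicator_unit_interval:
  assumes "x \<in> space (leb_pi d)"
  shows "(\<Prod>k<d. indicat_real {0..<1} (x k)) = indicator (pi_cube d) x"
proof (cases "x \<in> pi_cube d")
  case True
  then show ?thesis by (auto simp: PiE_iff)
next
  case False
  then obtain k where "k < d" "x k \<notin> {0..<1}"
    using assms by (auto simp: space_leb_pi PiE_iff)
  then show ?thesis using False by (auto intro!: prod_zero bexI[of _ k])
qed

lemma integrable_unit_interval:
  fixes f :: "real \<Rightarrow> real"
  assumes "continuous_on {0..1} f"
  shows "integrable lborel (\<lambda>t. indicat_real {0..<1} t * f t)"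
proof -
  have "set_integrable lborel {0..1} f"
    unfolding set_integrable_def by (rule borel_integrable_compact) (use assms in auto)
  then have "set_integrable lborel {0..<1} f"
    by (rule set_integrable_subset) auto
  then show ?thesis by (simp add: set_integrable_def)
qed

lemma integral_centered: "(LBINT t. indicat_real {0..<1} t * (t - 1 / 2)) = 0"
proof -
  \<comment> \<open>The half-open and the closed interval differ in a null set; on the latter,
    \<open>t\<^sup>2 / 2 - t / 2\<close> is an antiderivative.\<close>
  have "(LBINT t. indicat_real {0..<1} t * (t - 1 / 2)) = (LBINT t. (t - 1 / 2) * indicat_real {0..1} t)"
    by (rule integral_cong_AE)
      (auto intro!: eventually_mono[OF AE_lborel_singleton[of 1]] simp: indicator_def)
  also have "\<dots> = ((1 :: real)\<^sup>2 / 2 - 1 / 2) - (0\<^sup>2 / 2 - 0 / 2)"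
    by (rule integral_FTC_Icc_real) (auto intro!: derivative_eq_intros continuous_intros)
  finally show ?thesis by simp
qed

text \<open>The coordinates of a random point of the cube are independent and uniform: the integrand
  is a product of functions of single coordinates, so the integral factors, and for
  \<open>i \<noteq> j\<close> a centered factor integrates to 0. On the diagonal the pointwise bound
  1/4 is enough.\<close>

lemma
  assumes i: "i < d" and j: "j < d"
  shows integrable_coord_product:
      "integrable (leb_pi d) (\<lambda>x. indicator (pi_cube d) x * ((x i - 1 / 2) * (x j - 1 / 2)))"
    and integral_coord_product_le:
      "(LINT x|leb_pi d. indicator (pi_cube d) x * ((x i - 1 / 2) * (x j - 1 / 2))) \<le> 1 / 4"
    and integral_coord_product_neq:
      "i \<noteq> j \<Longrightarrow> (LINT x|leb_pi d. indicator (pi_cube d) x * ((x i - 1 / 2) * (x j - 1 / 2))) = 0"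
proof -
  \<comment> \<open>Two separate case distinctions make the factor at \<open>i\<close> a square when
    \<open>i = j\<close>.\<close>
  define f where "f k t = indicat_real {0..<1} t *
    ((if k = i then t - 1 / 2 else 1) * (if k = j then t - 1 / 2 else 1))" for k t
  have f: "integrable lborel (f k)" for k
    unfolding f_def
    by (rule integrable_unit_interval, cases "k = i"; cases "k = j") (auto intro!: continuous_intros)
  have eq: "(\<Prod>k<d. f k (x k)) = indicator (pi_cube d) x * ((x i - 1 / 2) * (x j - 1 / 2))"
    if "x \<in> space (leb_pi d)" for x
    using i j by (simp add: f_def prod.distrib prod_indicator_unit_interval[OF that])
  have "integrable (leb_pi d) (\<lambda>x. \<Prod>k<d. f k (x k))"
    by (rule lborel_product.product_integrable_prod) (use f in auto)
  then show int: "integrable (leb_pi d) (\<lambda>x. indicator (pi_cube d) x * ((x i - 1 / 2) * (x j - 1 / 2)))"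
    by (subst (asm) Bochner_Integration.integrable_cong[OF refl eq]) auto
  show neq: "(LINT x|leb_pi d. indicator (pi_cube d) x * ((x i - 1 / 2) * (x j - 1 / 2))) = 0" if "i \<noteq> j"
  proof -
    have "(LINT x|leb_pi d. indicator (pi_cube d) x * ((x i - 1 / 2) * (x j - 1 / 2)))
        = (LINT x|leb_pi d. (\<Prod>k<d. f k (x k)))"
      by (rule Bochner_Integration.integral_cong) (simp_all add: eq)
    also have "\<dots> = (\<Prod>k<d. integral\<^sup>L lborel (f k))"
      by (rule lborel_product.product_integral_prod) (use f in auto)
    also have "integral\<^sup>L lborel (f i) = 0"
      using integral_centered that by (simp add: f_def[abs_def])
    then have "(\<Prod>k<d. integral\<^sup>L lborel (f k)) = 0"
      using i by (intro prod_zero) auto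
    finally show ?thesis .
  qed
  show "(LINT x|leb_pi d. indicator (pi_cube d) x * ((x i - 1 / 2) * (x j - 1 / 2))) \<le> 1 / 4"
  proof (cases "i = j")
    case True
    have ind: "integrable (leb_pi d) (\<lambda>x. indicat_real (pi_cube d) x * (1 / 4))"
      by (intro integrable_mult_left integrable_real_indicator pi_cube_sets)
        (simp add: emeasure_pi_cube)
    have "(LINT x|leb_pi d. indicator (pi_cube d) x * ((x i - 1 / 2) * (x j - 1 / 2)))
        \<le> (LINT x|leb_pi d. indicator (pi_cube d) x * (1 / 4))"
    proof (rule integral_mono[OF int ind])
      fix x
      show "indicat_real (pi_cube d) x * ((x i - 1 / 2) * (x j - 1 / 2)) \<le> indicator (pi_cube d) x * (1 / 4)"
      proof (cases "x \<in> pi_cube d")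
        case x: True
        then have "0 \<le> x i" "x i < 1" using i by (auto simp: PiE_iff)
        then have "\<bar>x i - 1 / 2\<bar> \<le> 1 / 2" by linarith
        then have "\<bar>x i - 1 / 2\<bar>\<^sup>2 \<le> (1 / 2)\<^sup>2" by (intro power_mono) auto
        then show ?thesis using x True by (simp add: power2_eq_square)
      qed simp
    qed
    also have "\<dots> = 1 / 4"
      using measure_pi_cube sets.sets_into_space[OF pi_cube_sets[of d]] by (simp add: Int_absorb2)
    finally show ?thesis using True by simp
  qed (simp add: neq)
qed

text \<open>\<open>u\<close> is the squared deviation of the form from its mean. When it is
  expanded, the covariances vanish and each diagonal term is at most
  \<open>(z i)\<^sup>2 / 4\<close>.\<close>

lemma
  defines "u z d \<equiv> \<lambda>x. (ip d z x - (\<Sum>i<d. of_int (z i)) / 2)\<^sup>2"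
  shows set_integrable_variance: "set_integrable (leb_pi d) (pi_cube d) (u z d)"
    and variance_le: "(LINT x:pi_cube d|leb_pi d. u z d x) \<le> (L2_set (\<lambda>i. of_int (z i)) {..<d})\<^sup>2 / 4"
proof -
  define g where "g i j x = indicat_real (pi_cube d) x * ((x i - 1 / 2) * (x j - 1 / 2))"
    for i j :: nat and x
  have g_int: "integrable (leb_pi d) (g i j)" if "i < d" "j < d" for i j
    unfolding g_def by (rule integrable_coord_product[OF that])
  have eq: "indicat_real (pi_cube d) x *\<^sub>R u z d x
      = (\<Sum>i<d. \<Sum>j<d. of_int (z i * z j) * g i j x)" for x
  proof -
    have "ip d z x - (\<Sum>i<d. of_int (z i)) / 2 = (\<Sum>i<d. of_int (z i) * (x i - 1 / 2))"
      by (simp add: ip_def algebra_simps sum_subtractf sum_divide_distrib)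
    then have "indicat_real (pi_cube d) x *\<^sub>R u z d x = indicat_real (pi_cube d) x *
        ((\<Sum>i<d. of_int (z i) * (x i - 1 / 2)) * (\<Sum>j<d. of_int (z j) * (x j - 1 / 2)))"
      by (simp add: u_def power2_eq_square)
    also have "\<dots> = (\<Sum>i<d. \<Sum>j<d. of_int (z i * z j) * g i j x)"
      unfolding sum_product unfolding sum_distrib_left g_def by (intro sum.cong refl) simp
    finally show ?thesis .
  qed
  have int: "integrable (leb_pi d) (\<lambda>x. \<Sum>i<d. \<Sum>j<d. of_int (z i * z j) * g i j x)"
    by (intro Bochner_Integration.integrable_sum integrable_mult_right g_int) auto
  then show "set_integrable (leb_pi d) (pi_cube d) (u z d)"
    unfolding set_integrable_def eq .
  have "(LINT x:pi_cube d|leb_pi d. u z d x)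
      = (\<Sum>i<d. \<Sum>j<d. of_int (z i * z j) * integral\<^sup>L (leb_pi d) (g i j))"
    unfolding set_lebesgue_integral_def eq
    by (subst Bochner_Integration.integral_sum, intro Bochner_Integration.integrable_sum integrable_mult_right g_int, simp, simp,
        intro sum.cong refl, subst Bochner_Integration.integral_sum)
      (auto intro!: g_int)
  also have "\<dots> \<le> (\<Sum>i<d. \<Sum>j<d. if i = j then (of_int (z i))\<^sup>2 / 4 else 0)"
  proof (intro sum_mono)
    fix i j assume ij: "i \<in> {..<d}" "j \<in> {..<d}"
    show "of_int (z i * z j) * integral\<^sup>L (leb_pi d) (g i j) \<le> (if i = j then (of_int (z i))\<^sup>2 / 4 else 0)"
    proof (cases "i = j")
      case True
      have "(of_int (z i))\<^sup>2 * integral\<^sup>L (leb_pi d) (g i i) \<le> (of_int (z i))\<^sup>2 * (1 / 4)"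
        using integral_coord_product_le[of i d i] ij
        by (intro mult_left_mono) (auto simp: g_def[abs_def])
      then show ?thesis using True by (simp add: power2_eq_square)
    next
      case False
      then show ?thesis
        using integral_coord_product_neq[of i d j] ij by (simp add: g_def[abs_def])
    qed
  qed
  also have "\<dots> = (L2_set (\<lambda>i. of_int (z i)) {..<d})\<^sup>2 / 4"
    by (simp add: L2_set_def sum_nonneg sum_divide_distrib)
  finally show "(LINT x:pi_cube d|leb_pi d. u z d x) \<le> (L2_set (\<lambda>i. of_int (z i)) {..<d})\<^sup>2 / 4" .
qed

lemma L2_set_int_ge_1:
  fixes d :: nat
  assumes "\<exists>i<d. z i \<noteq> (0 :: int)"
  shows "L2_set (\<lambda>i. real_of_int (z i)) {..<d} \<ge> 1"
proof -
  obtain j where j: "j < d" "z j \<noteq> 0" using assms by blast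
  have "1 \<le> \<bar>real_of_int (z j)\<bar>" using j by linarith
  also have "\<dots> \<le> L2_set (\<lambda>i. \<bar>real_of_int (z i)\<bar>) {..<d}"
    using j by (intro member_le_L2_set[where f = "\<lambda>i. \<bar>real_of_int (z i)\<bar>"]) auto
  also have "\<dots> = L2_set (\<lambda>i. real_of_int (z i)) {..<d}" by (simp add: L2_set_def)
  finally show ?thesis .
qed

text \<open>Chebyshev's inequality with deviation \<open>l\<close>: up to a null set, at most
  \<open>4 * l\<close> slabs cover a set of measure at least 3/4, whence the constant 3/16.\<close>

lemma exists_slab_measure_ge_variance:
  assumes z: "\<exists>i<d. z i \<noteq> 0"
  obtains m where "measure (leb_pi d) (slab d z m) \<ge> 3 / (16 * L2_set (\<lambda>i. real_of_int (z i)) {..<d})"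
proof -
  define l where "l = L2_set (\<lambda>i. real_of_int (z i)) {..<d}"
  define c where "c = (\<Sum>i<d. real_of_int (z i)) / 2"
  have l: "l \<ge> 1" unfolding l_def by (rule L2_set_int_ge_1[OF z])
  define F where "F = {x \<in> pi_cube d. (ip d z x - c)\<^sup>2 \<ge> l\<^sup>2}"
  define E where "E = pi_cube d - F"
  have F: "F \<in> sets (leb_pi d)"
  proof -
    have "F = pi_cube d \<inter> {x \<in> space (leb_pi d). (ip d z x - c)\<^sup>2 \<ge> l\<^sup>2}"
      using sets.sets_into_space[OF pi_cube_sets[of d]] unfolding F_def by blast
    also have "\<dots> \<in> sets (leb_pi d)" by measurable
    finally show ?thesis .
  qed
  have E: "E \<in> sets (leb_pi d)" unfolding E_def using F by (intro sets.Diff pi_cube_sets)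
  have "measure (leb_pi d) F \<le> (LINT x:pi_cube d|leb_pi d. (ip d z x - c)\<^sup>2) / l\<^sup>2"
    unfolding F_def c_def
    by (rule integral_Markov_inequality'_measure[OF set_integrable_variance pi_cube_sets]) (use l in auto)
  also have "\<dots> \<le> (l\<^sup>2 / 4) / l\<^sup>2"
    unfolding c_def l_def by (intro divide_right_mono variance_le) simp
  also have "\<dots> = 1 / 4" using l by simp
  finally have "measure (leb_pi d) F \<le> 1 / 4" .
  moreover have "measure (leb_pi d) E = measure (leb_pi d) (pi_cube d) - measure (leb_pi d) F"
    unfolding E_def
  proof (rule measure_Diff[OF _ pi_cube_sets F])
    show "emeasure (leb_pi d) (pi_cube d) \<noteq> \<infinity>" by (simp add: emeasure_pi_cube)
    show "F \<subseteq> pi_cube d" unfolding F_def by blast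
  qed
  ultimately have mE: "measure (leb_pi d) E \<ge> 3 / 4" unfolding measure_pi_cube by linarith
  \<comment> \<open>Floors over an interval of length \<open>2 * l\<close> take at most
    \<open>2 * l + 2\<close> values, which is at most \<open>4 * l\<close> because
    \<open>l \<ge> 1\<close>.\<close>
  define K where "K = {\<lfloor>c - l\<rfloor>..\<lfloor>c + l\<rfloor>}"
  have K: "\<lfloor>ip d z x\<rfloor> \<in> K" if "x \<in> E" for x
  proof -
    have "\<not> (ip d z x - c)\<^sup>2 \<ge> l\<^sup>2" using that unfolding E_def F_def by blast
    then have "\<bar>ip d z x - c\<bar>\<^sup>2 < l\<^sup>2" by simp
    then have "\<bar>ip d z x - c\<bar> < l" by (rule power2_less_imp_less) (use l in simp)
    then have "c - l \<le> ip d z x" "ip d z x \<le> c + l" by linarith+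
    then show ?thesis unfolding K_def by (simp add: floor_mono)
  qed
  have "\<exists>m. measure (leb_pi d) E \<le> real (card K) * measure (leb_pi d) (slab d z m)"
  proof (rule exists_large_slab[OF z E])
    show "E \<subseteq> pi_cube d" "finite K" by (auto simp: E_def K_def)
    show "measure (leb_pi d) E > 0" using mE by linarith
  qed (use K in blast)+
  then obtain m where m: "measure (leb_pi d) E \<le> real (card K) * measure (leb_pi d) (slab d z m)"
    by blast
  have "real (card K) \<le> 4 * l"
  proof -
    have "real (card K) = of_int (\<lfloor>c + l\<rfloor> - \<lfloor>c - l\<rfloor> + 1)"
      unfolding K_def using l by (simp add: floor_mono)
    also have "\<dots> \<le> 2 * l + 2" by linarith
    finally show ?thesis using l by simp
  qed
  then have "real (card K) * measure (leb_pi d) (slab d z m) \<le> 4 * l * measure (leb_pi d) (slab d z m)"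
    by (intro mult_right_mono) auto
  then have "3 / 4 \<le> 4 * l * measure (leb_pi d) (slab d z m)" using m mE by linarith
  then show ?thesis
    using l by (intro that[of m]) (simp add: l_def[symmetric] field_simps)
qed

lemma exists_slab_measure_ge_range:
  assumes z: "\<exists>i<d. z i \<noteq> 0"
  obtains m where "measure (leb_pi d) (slab d z m) \<ge> 1 / (sqrt (real d) * L2_set (\<lambda>i. real_of_int (z i)) {..<d})"
proof -
  define l where "l = L2_set (\<lambda>i. real_of_int (z i)) {..<d}"
  have l: "l \<ge> 1" unfolding l_def by (rule L2_set_int_ge_1[OF z])
  \<comment> \<open>The form lies between the sum of the negative and the sum of the positive
    entries of \<open>z\<close> on the cube.\<close>
  define a b where "a = (\<Sum>i<d. min (z i) 0)" and "b = (\<Sum>i<d. max (z i) 0)"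
  have range: "of_int a \<le> ip d z x \<and> ip d z x \<le> of_int b" if "x \<in> pi_cube d" for x
  proof -
    have "of_int (min (z i) 0) \<le> of_int (z i) * x i" "of_int (z i) * x i \<le> of_int (max (z i) 0)"
      if "i < d" for i
    proof -
      have x: "0 \<le> x i" "x i \<le> 1" using \<open>x \<in> pi_cube d\<close> that by (auto simp: PiE_iff less_imp_le)
      show "of_int (min (z i) 0) \<le> of_int (z i) * x i"
      proof (cases "z i \<ge> 0")
        case False
        then have "of_int (z i) * 1 \<le> of_int (z i) * x i" using x by (intro mult_left_mono_neg) auto
        then show ?thesis using False by simp
      qed (use x in simp)
      show "of_int (z i) * x i \<le> of_int (max (z i) 0)"
      proof (cases "z i \<ge> 0")
        case True
        then have "of_int (z i) * x i \<le> of_int (z i) * 1" using x by (intro mult_left_mono) auto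
        then show ?thesis using True by simp
      qed (use x in \<open>simp add: mult_nonpos_nonneg\<close>)
    qed
    then show ?thesis
      unfolding a_def b_def ip_def of_int_sum by (intro conjI sum_mono) auto
  qed
  \<comment> \<open>A non-integer value is below \<open>b\<close>, so its floor is at most
    \<open>b - 1\<close>. The half-open interval makes the number of slabs exactly
    \<open>b - a\<close>, the \<open>l\<^sup>1\<close> norm of \<open>z\<close>.\<close>
  have K: "\<lfloor>ip d z x\<rfloor> \<in> {a..<b}" if "x \<in> pi_cube d" "ip d z x \<notin> \<int>" for x
  proof -
    have "ip d z x \<noteq> of_int b" using that(2) by auto
    then show ?thesis using range[OF that(1)] by (simp add: le_floor_iff floor_less_iff)
  qed
  have "\<exists>m. measure (leb_pi d) (pi_cube d) \<le> real (card {a..<b}) * measure (leb_pi d) (slab d z m)"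
  proof (rule exists_large_slab[OF z pi_cube_sets subset_refl])
    show "finite {a..<b}" by simp
    show "measure (leb_pi d) (pi_cube d) > 0" by (simp add: measure_pi_cube)
  qed (use K in blast)+
  then obtain m where m: "1 \<le> real (card {a..<b}) * measure (leb_pi d) (slab d z m)"
    unfolding measure_pi_cube by blast
  have "real (card {a..<b}) = (\<Sum>i<d. \<bar>of_int (z i)\<bar>)"
  proof -
    have "b - a = (\<Sum>i<d. \<bar>z i\<bar>)"
      unfolding a_def b_def sum_subtractf[symmetric] by (intro sum.cong) auto
    then show ?thesis by (simp add: sum_nonneg)
  qed
  \<comment> \<open>The factor 1 prepares Cauchy-Schwarz with the all-ones vector, whose norm is
    \<open>sqrt (real d)\<close>.\<close>
  also have "\<dots> = (\<Sum>i<d. \<bar>of_int (z i)\<bar> * \<bar>1\<bar>)" by simp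
  also have "\<dots> \<le> l * L2_set (\<lambda>_. 1) {..<d}"
    unfolding l_def by (rule L2_set_mult_ineq)
  also have "\<dots> = sqrt (real d) * l" by (simp add: L2_set_def)
  finally have "real (card {a..<b}) * measure (leb_pi d) (slab d z m)
      \<le> sqrt (real d) * l * measure (leb_pi d) (slab d z m)"
    by (intro mult_right_mono) auto
  with m have "1 \<le> sqrt (real d) * l * measure (leb_pi d) (slab d z m)" by linarith
  moreover have "sqrt (real d) * l > 0" using z l by auto
  ultimately show ?thesis
    by (intro that[of m]) (simp add: l_def[symmetric] field_simps)
qed

subsection \<open>Isotropic discrepancy\<close>

lemma ip_linear: "ip d z (\<lambda>i. u * x i + v * y i) = u * ip d z x + v * ip d z y"
  by (simp add: ip_def sum.distrib sum_distrib_left algebra_simps)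

lemma ip_restrict: "ip d z (restrict x {..<d}) = ip d z x"
  by (simp add: ip_def)

text \<open>The counterpart of \<open>slab\<close> in the type of the convex sets over which the
  discrepancy is taken.\<close>

definition rvec_slab :: "nat \<Rightarrow> (nat \<Rightarrow> int) \<Rightarrow> int \<Rightarrow> rvec set" where
  "rvec_slab d z m = {x \<in> unit_cube d. of_int m < ip d z (Poly_Mapping.lookup x) \<and>
     ip d z (Poly_Mapping.lookup x) < of_int m + 1}"

lemma convex_rvec_slab: "convex (rvec_slab d z m)"
proof (rule convexI)
  fix x y and u v :: real
  assume x: "x \<in> rvec_slab d z m" and y: "y \<in> rvec_slab d z m"
    and uv: "0 \<le> u" "0 \<le> v" "u + v = 1"
  have lookup: "Poly_Mapping.lookup (u *\<^sub>R x + v *\<^sub>R y)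
      = (\<lambda>i. u * Poly_Mapping.lookup x i + v * Poly_Mapping.lookup y i)"
    by (rule ext) (simp add: lookup_add)
  have lt: "u * a + v * b < c" if "a < c" "b < c" for a b c :: real
    using convex_bound_lt[OF that uv] .
  have gt: "c < u * a + v * b" if "c < a" "c < b" for a b c :: real
    using lt[of "- a" "- c" "- b"] that by simp
  have "u *\<^sub>R x + v *\<^sub>R y \<in> unit_cube d"
    using x y uv unfolding rvec_slab_def unit_cube_def
    by (auto simp: lookup mem_Rd_iff intro!: lt)
  moreover have "of_int m < ip d z (Poly_Mapping.lookup (u *\<^sub>R x + v *\<^sub>R y)) \<and>
     ip d z (Poly_Mapping.lookup (u *\<^sub>R x + v *\<^sub>R y)) < of_int m + 1"
    unfolding lookup ip_linear using x y unfolding rvec_slab_def by (auto intro!: lt gt)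
  ultimately show "u *\<^sub>R x + v *\<^sub>R y \<in> rvec_slab d z m"
    unfolding rvec_slab_def by blast
qed

lemma rvec_slab_subset: "rvec_slab d z m \<subseteq> unit_cube d"
  unfolding rvec_slab_def by blast

lemma image_unit_cube_subset:
  "C \<subseteq> unit_cube d \<Longrightarrow> (\<lambda>x. restrict (Poly_Mapping.lookup x) {..<d}) ` C \<subseteq> pi_cube d"
  by (auto simp: unit_cube_def split: if_splits)

lemma image_rvec_slab:
  "(\<lambda>x. restrict (Poly_Mapping.lookup x) {..<d}) ` rvec_slab d z m = slab d z m"
proof
  show "(\<lambda>x. restrict (Poly_Mapping.lookup x) {..<d}) ` rvec_slab d z m \<subseteq> slab d z m"
    by (auto simp: rvec_slab_def slab_def unit_cube_def ip_restrict split: if_splits)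
  show "slab d z m \<subseteq> (\<lambda>x. restrict (Poly_Mapping.lookup x) {..<d}) ` rvec_slab d z m"
  proof
    fix y assume y: "y \<in> slab d z m"
    \<comment> \<open>The preimage is 0 beyond the first \<open>d\<close> coordinates, where
      \<open>y\<close> itself is \<open>undefined\<close>.\<close>
    define x where "x = Abs_poly_mapping (\<lambda>i. if i < d then y i else 0)"
    have "finite {i. (if i < d then y i else 0) \<noteq> 0}"
      by (rule finite_subset[of _ "{..<d}"]) auto
    then have lookup: "Poly_Mapping.lookup x = (\<lambda>i. if i < d then y i else 0)"
      by (simp add: x_def Abs_poly_mapping_inverse)
    have yx: "y = restrict (Poly_Mapping.lookup x) {..<d}"
      using y by (intro ext) (auto simp: lookup slab_def PiE_iff extensional_def)
    moreover have "x \<in> rvec_slab d z m"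
      using y ip_restrict[of d z "Poly_Mapping.lookup x"] unfolding yx[symmetric]
      by (auto simp: rvec_slab_def slab_def unit_cube_def mem_Rd_iff lookup PiE_iff)
    ultimately show "y \<in> (\<lambda>x. restrict (Poly_Mapping.lookup x) {..<d}) ` rvec_slab d z m"
      by (rule image_eqI)
  qed
qed

lemma lebesgue_volume_rvec_slab:
  "lebesgue_volume d (rvec_slab d z m) = measure (leb_pi d) (slab d z m)"
  unfolding lebesgue_volume_def image_rvec_slab by (rule measure_completion[OF slab_sets])

text \<open>Monotonicity asks only for measurability of the cube: a non-measurable image has
  \<open>emeasure\<close> 0 by convention.\<close>

lemma lebesgue_volume_le_1:
  assumes "C \<subseteq> unit_cube d"
  shows "lebesgue_volume d C \<le> 1"
proof -
  let ?A = "(\<lambda>x. restrict (Poly_Mapping.lookup x) {..<d}) ` C"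
  let ?M = "completion (leb_pi d)"
  have cube: "emeasure ?M (pi_cube d) = 1"
    using emeasure_pi_cube[of d] by (subst emeasure_completion) (auto simp: main_part_sets)
  have "emeasure ?M ?A \<le> emeasure ?M (pi_cube d)"
    using image_unit_cube_subset[OF assms] by (intro emeasure_mono) auto
  then have "enn2real (emeasure ?M ?A) \<le> enn2real 1"
    unfolding cube by (intro enn2real_mono) auto
  then show ?thesis by (simp add: lebesgue_volume_def measure_def)
qed

text \<open>A real supremum dominates its members once they are bounded above; here 1 is a bound, as
  counting fraction and volume lie in \<open>[0,1]\<close>.\<close>

lemma discrepancy_upper:
  assumes "convex C" "C \<subseteq> unit_cube d"
  shows "\<bar>real (card (P \<inter> C)) / real (card P) - lebesgue_volume d C\<bar> \<le> isotropic_discrepancy d P"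
  unfolding isotropic_discrepancy_def
proof (rule cSUP_upper)
  show "C \<in> {C. convex C \<and> C \<subseteq> unit_cube d}" using assms by blast
  show "bdd_above ((\<lambda>C. \<bar>real (card (P \<inter> C)) / real (card P) - lebesgue_volume d C\<bar>)
      ` {C. convex C \<and> C \<subseteq> unit_cube d})"
  proof (rule bdd_aboveI2)
    fix C assume "C \<in> {C. convex C \<and> C \<subseteq> unit_cube d}"
    then have "lebesgue_volume d C \<le> 1" by (intro lebesgue_volume_le_1) blast
    moreover have "lebesgue_volume d C \<ge> 0" by (simp add: lebesgue_volume_def)
    \<comment> \<open>For infinite \<open>P\<close> the denominator is 0 and so is the
      quotient.\<close>
    moreover have "real (card (P \<inter> C)) / real (card P) \<le> 1"
      by (cases "finite P") (auto simp: divide_le_eq_1 card_mono card_gt_0_iff)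
    moreover have "real (card (P \<inter> C)) / real (card P) \<ge> 0" by simp
    ultimately show "\<bar>real (card (P \<inter> C)) / real (card P) - lebesgue_volume d C\<bar> \<le> 1"
      by linarith
  qed
qed

lemma discrepancy_nonneg: "isotropic_discrepancy d P \<ge> 0"
  by (rule order_trans[OF abs_ge_zero discrepancy_upper[of "{}"]]) auto

text \<open>A dual form is integral on \<open>L\<close>, and no integer lies strictly between
  \<open>m\<close> and \<open>m + 1\<close>. The counting term of the slab is 0, which leaves its
  volume.\<close>

lemma discrepancy_ge_slab:
  assumes "in_dual d L z"
  shows "isotropic_discrepancy d (lattice_points d L) \<ge> measure (leb_pi d) (slab d z m)"
proof -
  have "lattice_points d L \<inter> rvec_slab d z m = {}"
  proof (rule ccontr)
    assume "\<not> ?thesis"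
    then obtain g where "g \<in> L" "g \<in> rvec_slab d z m"
      by (auto simp: lattice_points_def)
    then obtain n :: int where "of_int m < real_of_int n" "real_of_int n < of_int m + 1"
      using assms by (auto simp: in_dual_def rvec_slab_def elim!: Ints_cases)
    then have "m < n" "n < m + 1" by linarith+
    then show False by simp
  qed
  then show ?thesis
    using discrepancy_upper[where P = "lattice_points d L", OF convex_rvec_slab[of d z m] rvec_slab_subset]
    by (simp add: lebesgue_volume_rvec_slab)
qed

text \<open>\<open>q\<close> is the reciprocal of the Minkowski radius \<open>R\<close>. Both bounds
  hold with any \<open>r > R\<close> in place of \<open>R\<close>, and letting \<open>r\<close> tend
  to \<open>R\<close> gives the claim.\<close>

lemma discrepancy_ge:
  assumes L: "integration_lattice d L" and d: "d \<ge> 1" and N: "card (lattice_points d L) > 0"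
  defines "q \<equiv> 1 / 2 * sqrt pi * Gamma (real d / 2 + 1) powr (- 1 / real d)
    / real (card (lattice_points d L)) powr (1 / real d)"
  shows "isotropic_discrepancy d (lattice_points d L) \<ge> q / sqrt (real d)"
    and "isotropic_discrepancy d (lattice_points d L) \<ge> 3 / 16 * q"
proof -
  let ?P = "lattice_points d L" and ?J = "isotropic_discrepancy d (lattice_points d L)"
  let ?V = "unit_ball_vol (real d)"
  \<comment> \<open>Chosen so that the ball of radius \<open>R / 2\<close> has volume
    \<open>card ?P\<close>.\<close>
  define R where "R = 2 * (real (card ?P) / ?V) powr (1 / real d)"
  have G: "Gamma (real d / 2 + 1) > 0" by (intro Gamma_real_pos) simp
  have V: "?V > 0" by simp
  then have V0: "?V \<noteq> 0" by linarith
  have R: "R > 0" using N V0 by (simp add: R_def)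
  \<comment> \<open>The \<open>d\<close>-th root of \<open>?V\<close>, the quotient of
    \<open>pi powr (d / 2)\<close> and the Gamma value, yields \<open>sqrt pi\<close> and the Gamma
    power.\<close>
  have q: "q = 1 / R"
    using G N d V
    by (simp add: q_def R_def unit_ball_vol_def powr_divide powr_mult powr_powr powr_minus_divide powr_half_sqrt)
  \<comment> \<open>\<open>r > R\<close> gives the strict volume inequality that the existence of a
    short dual vector rests on.\<close>
  have bound: "1 / (sqrt (real d) * r) \<le> ?J \<and> 3 / (16 * r) \<le> ?J" if "r > R" for r
  proof -
    have "(R / 2) ^ d = real (card ?P) / ?V"
      using d N V0 by (simp add: R_def powr_realpow[symmetric] powr_powr)
    moreover have "(R / 2) ^ d < (r / 2) ^ d"
      using that R d by (intro power_strict_mono) auto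
    ultimately have "real (card ?P) < ?V * (r / 2) ^ d"
      using V by (simp add: divide_less_eq mult.commute)
    moreover have "finite (lattice_points d L)" using N by (simp add: card_gt_0_iff)
    moreover have "r > 0" using R that by linarith
    ultimately obtain z where z: "\<exists>i<d. z i \<noteq> 0" "in_dual d L z"
        and le: "L2_set (\<lambda>i. real_of_int (z i)) {..<d} \<le> r"
      using exists_short_dual_vector[OF L] by metis
    have l: "L2_set (\<lambda>i. real_of_int (z i)) {..<d} \<ge> 1" by (rule L2_set_int_ge_1[OF z(1)])
    obtain m where "1 / (sqrt (real d) * L2_set (\<lambda>i. real_of_int (z i)) {..<d})
        \<le> measure (leb_pi d) (slab d z m)"
      using exists_slab_measure_ge_range[OF z(1)] .
    moreover have "1 / (sqrt (real d) * r) \<le> 1 / (sqrt (real d) * L2_set (\<lambda>i. real_of_int (z i)) {..<d})"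
      using le l d by (intro divide_left_mono mult_left_mono mult_pos_pos) auto
    ultimately have "1 / (sqrt (real d) * r) \<le> ?J"
      using discrepancy_ge_slab[OF z(2), of m] by linarith
    moreover obtain m' where "3 / (16 * L2_set (\<lambda>i. real_of_int (z i)) {..<d})
        \<le> measure (leb_pi d) (slab d z m')"
      using exists_slab_measure_ge_variance[OF z(1)] .
    moreover have "3 / (16 * r) \<le> 3 / (16 * L2_set (\<lambda>i. real_of_int (z i)) {..<d})"
      using le l by (intro divide_left_mono mult_left_mono mult_pos_pos) auto
    ultimately show ?thesis
      using discrepancy_ge_slab[OF z(2), of m'] by linarith
  qed
  have lim: "k / R \<le> ?J" if "\<And>r. r > R \<Longrightarrow> k / r \<le> ?J" and "k > 0" for k
  proof -
    \<comment> \<open>With \<open>?J\<close> positive, the bounds turn into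
      \<open>k / ?J \<le> r\<close> for all \<open>r > R\<close>, and density of the reals gives
      \<open>k / ?J \<le> R\<close>.\<close>
    have "0 < k / (R + 1)" using \<open>k > 0\<close> R by simp
    then have J: "?J > 0" using that(1)[of "R + 1"] by linarith
    have "k / ?J \<le> R"
    proof (rule dense_ge)
      fix r assume "R < r"
      then show "k / ?J \<le> r" using that(1)[of r] R J by (simp add: field_simps)
    qed
    then show ?thesis using R J by (simp add: field_simps)
  qed
  have "1 / sqrt (real d) / R \<le> ?J" using bound d by (intro lim) auto
  then show "q / sqrt (real d) \<le> ?J" by (simp add: q mult.commute)
  have "3 / 16 / R \<le> ?J" using bound by (intro lim) auto
  then show "3 / 16 * q \<le> ?J" by (simp add: q)
qed

theorem theorem1:
  shows "(\<forall>(d::nat) (N::nat) (L::rvec set).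
            d \<ge> 1 \<and> integration_lattice d L \<and> card (lattice_points d L) = N \<longrightarrow>
            isotropic_discrepancy d (lattice_points d L)
              \<ge> (1/2 * sqrt (pi / real d) * Gamma (real d / 2 + 1) powr (- 1 / real d))
                  / real N powr (1 / real d))
       \<and> (\<exists>c::real. c > 0 \<and>
            (\<forall>(d::nat) (N::nat) (L::rvec set).
               d \<ge> 1 \<and> integration_lattice d L \<and> card (lattice_points d L) = N
                 \<and> spectral_test d L \<le> 1/2 \<longrightarrow>
               isotropic_discrepancy d (lattice_points d L)
                 \<ge> c * Gamma (real d / 2 + 1) powr (- 1 / real d) * (1 / real N powr (1 / real d))))"
proof (intro conjI exI[of _ "3 / 32 * sqrt pi"] allI impI)
  fix d N :: nat and L
  assume a: "d \<ge> 1 \<and> integration_lattice d L \<and> card (lattice_points d L) = N"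
  show "isotropic_discrepancy d (lattice_points d L)
      \<ge> (1/2 * sqrt (pi / real d) * Gamma (real d / 2 + 1) powr (- 1 / real d)) / real N powr (1 / real d)"
    \<comment> \<open>For an infinite point set \<open>N = 0\<close>, and both right-hand sides vanish.\<close>
  proof (cases "N = 0")
    case False
    then show ?thesis
      using discrepancy_ge(1)[of d L] a by (simp add: real_sqrt_divide mult_ac)
  qed (simp add: discrepancy_nonneg)
next
  fix d N :: nat and L
  assume a: "d \<ge> 1 \<and> integration_lattice d L \<and> card (lattice_points d L) = N \<and> spectral_test d L \<le> 1/2"
  \<comment> \<open>The constant 3/32 is 3/16 times the factor 1/2 in \<open>q\<close>.\<close>
  show "isotropic_discrepancy d (lattice_points d L)
      \<ge> 3 / 32 * sqrt pi * Gamma (real d / 2 + 1) powr (- 1 / real d) * (1 / real N powr (1 / real d))"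
  proof (cases "N = 0")
    case False
    then show ?thesis
      using discrepancy_ge(2)[of d L] a by (simp add: mult_ac)
  qed (simp add: discrepancy_nonneg)
qed simp

end
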